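(* Let $G$ be a signed block graph of order $n$ with $k$ blocks $B_1,\dots,B_k$, where $B_i$ has $n_i$ vertices. Suppose all edges incident to cut-vertices of $G$ are positive, and for each $i$ the block $B_i$ contains $m_i$ vertex-disjoint negative cliques, each on $r_i$ vertices, with $0\le m_ir_i\le n_i-1$, all other edges of $B_i$ being positive. Then $$\det(G)=(-1)^{n-k}\sum\prod_{i=1}^k(1-2r_i)^{m_i-1}(-1)^{-m_ir_i}\Big(\alpha_i(1-2r_i)+2r_i\big(1+m_i(r_i-1)\big)-1\Big),$$ where the sum is over all $k$-tuples $(\alpha_1,\dots,\alpha_k)$ of nonnegative integers such that (1) $\sum_{i=1}^k\alpha_i=n$, and (2) for every nonempty $S\subseteq\{1,\dots,k\}$, $\sum_{i\in S}\alpha_i\le|V(G_S)|$, where $G_S$ is the subgraph of $G$ induced by the blocks $B_i$, $i\in S$.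
   Context: A signed graph is a simple undirected graph with edge weights in $\{1,-1\}$ (positive/negative edges); $\det(G)$ is the determinant of its adjacency matrix, whose $(i,j)$ entry is the weight of edge $\{i,j\}$ and $0$ otherwise. A block is a maximal connected subgraph without a cut-vertex; a signed block graph is one in which each block is a signed complete graph. A negative clique is an induced complete subgraph all of whose edges have weight $-1$. *)

theory Defs
  imports "HOL-Analysis.Determinants" "HOL-Library.FuncSet" "HOL-Library.Disjoint_Sets"
begin

type_synonym 'v graph = "'v set \<times> 'v set set"

abbreviation verts :: "'v graph \<Rightarrow> 'v set" where "verts G \<equiv> fst G"
abbreviation edges :: "'v graph \<Rightarrow> 'v set set" where "edges G \<equiv> snd G"

definition simple_graph :: "'v graph \<Rightarrow> bool" where
  "simple_graph G \<longleftrightarrow> finite (verts G) \<and> (\<forall>e\<in>edges G. e \<subseteq> verts G \<and> card e = 2)"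

definition signed_graph :: "'v graph \<Rightarrow> ('v set \<Rightarrow> real) \<Rightarrow> bool" where
  "signed_graph G w \<longleftrightarrow> simple_graph G \<and> (\<forall>e\<in>edges G. w e \<in> {1, -1})"

definition adjacency_matrix :: "('v::finite) graph \<Rightarrow> ('v set \<Rightarrow> real) \<Rightarrow> real^'v^'v" where
  "adjacency_matrix G w = (\<chi> i j. if {i, j} \<in> edges G then w {i, j} else 0)"

definition is_subgraph :: "'v graph \<Rightarrow> 'v graph \<Rightarrow> bool" where
  "is_subgraph H G \<longleftrightarrow> simple_graph H \<and> verts H \<subseteq> verts G \<and> edges H \<subseteq> edges G"

definition linked :: "'v graph \<Rightarrow> 'v \<Rightarrow> 'v \<Rightarrow> bool" where
  "linked G = (\<lambda>u v. {u, v} \<in> edges G)\<^sup>*\<^sup>*"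

definition connected_graph :: "'v graph \<Rightarrow> bool" where
  "connected_graph G \<longleftrightarrow> verts G \<noteq> {} \<and> (\<forall>u\<in>verts G. \<forall>v\<in>verts G. linked G u v)"

definition graph_components :: "'v graph \<Rightarrow> 'v set set" where
  "graph_components G = (\<lambda>u. {v \<in> verts G. linked G u v}) ` verts G"

definition delete_vertex :: "'v graph \<Rightarrow> 'v \<Rightarrow> 'v graph" where
  "delete_vertex G x = (verts G - {x}, {e \<in> edges G. x \<notin> e})"

definition cut_vertex :: "'v graph \<Rightarrow> 'v \<Rightarrow> bool" where
  "cut_vertex G x \<longleftrightarrow> x \<in> verts G \<and>
     card (graph_components (delete_vertex G x)) > card (graph_components G)"

text \<open>The cut-vertices excluded here are those of the subgraph itself, not of the ambient graph.\<close>

definition nonseparable :: "'v graph \<Rightarrow> bool" where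
  "nonseparable H \<longleftrightarrow> connected_graph H \<and> (\<forall>x. \<not> cut_vertex H x)"

definition is_block :: "'v graph \<Rightarrow> 'v graph \<Rightarrow> bool" where
  "is_block G H \<longleftrightarrow> is_subgraph H G \<and> nonseparable H \<and>
     (\<forall>H'. is_subgraph H' G \<and> nonseparable H' \<and> is_subgraph H H' \<longrightarrow> H' = H)"

definition complete_graph :: "'v graph \<Rightarrow> bool" where
  "complete_graph G \<longleftrightarrow> (\<forall>u\<in>verts G. \<forall>v\<in>verts G. u \<noteq> v \<longrightarrow> {u, v} \<in> edges G)"

definition signed_block_graph :: "'v graph \<Rightarrow> ('v set \<Rightarrow> real) \<Rightarrow> bool" where
  "signed_block_graph G w \<longleftrightarrow> signed_graph G w \<and> (\<forall>H. is_block G H \<longrightarrow> complete_graph H)"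

text \<open>A clique is represented by its vertex set.\<close>

definition negative_clique :: "'v graph \<Rightarrow> ('v set \<Rightarrow> real) \<Rightarrow> 'v set \<Rightarrow> bool" where
  "negative_clique G w C \<longleftrightarrow> C \<subseteq> verts G \<and>
     (\<forall>u\<in>C. \<forall>v\<in>C. u \<noteq> v \<longrightarrow> {u, v} \<in> edges G \<and> w {u, v} = -1)"

definition admissible_tuples :: "'v graph \<Rightarrow> nat \<Rightarrow> (nat \<Rightarrow> 'v graph) \<Rightarrow> (nat \<Rightarrow> nat) set" where
  "admissible_tuples G k B = {\<alpha> \<in> {1..k} \<rightarrow>\<^sub>E UNIV.
     (\<Sum>i=1..k. \<alpha> i) = card (verts G) \<and>
     (\<forall>S. S \<noteq> {} \<and> S \<subseteq> {1..k} \<longrightarrow> (\<Sum>i\<in>S. \<alpha> i) \<le> card (\<Union>i\<in>S. verts (B i)))}"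

end

theory Submission imports Defs begin

text \<open>
  Blocks are linked in a tree-like fashion: two vertices of a block are not connected by edges
  outside that block. Hence a permutation that moves every vertex along an edge keeps each of its
  cycles inside one block, and the Leibniz formula turns the determinant into a sum, over all maps
  \<open>\<phi>\<close> sending each vertex to a block containing it, of determinants that are block diagonal along
  the fibres of \<open>\<phi>\<close>. On a fibre the matrix is \<open>J - I\<close> minus \<open>2 (J - I)\<close> on each negative clique (which
  contains no cut-vertex and so lies in a single fibre), a diagonal matrix plus orthogonal rank-one
  updates. Finally \<open>\<phi>\<close> is determined by its fibre sizes \<open>\<alpha>\<close>, again because there are no cycles of
  blocks, and by Hall's theorem the tuples that occur are exactly the admissible ones.
\<close>

section \<open>Determinants of rank-one updates\<close>

text \<open>Subtracting \<open>c t\<close> times row \<open>l\<close> from row \<open>t\<close>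
  restores an identity row without changing the determinant. What remains for empty \<open>S\<close>
  is the identity with one row replaced by \<open>y\<close>, which Cramer's rule evaluates.\<close>

lemma det_identity_replace_row:
  fixes y :: "'a::field^'n::finite"
  assumes "finite S" "l \<notin> S"
  shows "det (\<chi> i. if i = l then y else if i \<in> S then axis i 1 + c i *s y else axis i 1) = y $ l"
  using assms
proof (induction S rule: finite_induct)
  case empty
  have row: "row i (mat 1 :: 'a^'n^'n) = axis i 1" for i
    by (vector row_def mat_def axis_def)
  have "(\<Sum>i\<in>UNIV. y $ i *s row i (mat 1 :: 'a^'n^'n)) = y"
    by (simp add: row basis_expansion)
  then show ?case
    using cramer_lemma_transpose[of l y "mat 1 :: 'a^'n^'n"] by (simp add: row cong: if_cong)
next
  case (insert t S)
  let ?A = "\<chi> i. if i = l then y else if i \<in> S then axis i 1 + c i *s y else axis i 1"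
  have "(\<chi> i. if i = l then y else if i \<in> insert t S then axis i 1 + c i *s y else axis i 1)
     = (\<chi> i. if i = t then row t ?A + c t *s row l ?A else row i ?A)"
    using insert by (auto simp: vec_eq_iff row_def)
  then show ?case
    using insert det_row_operation[of t l ?A "c t"] by fastforce
qed

text \<open>The matrix determinant lemma for I + x y^T. Rows are updated one at a time: by linearity
  in row \<open>l\<close> the new determinant is the old one plus \<open>x $ l\<close> times a
  determinant with \<open>y\<close> in row \<open>l\<close>.\<close>

lemma det_identity_plus_rank_one:
  fixes x y :: "'a::field^'n::finite"
  shows "det (\<chi> i. axis i 1 + x $ i *s y) = 1 + (\<Sum>i\<in>UNIV. x $ i * y $ i)"
proof -
  have "det (\<chi> i. if i \<in> S then axis i 1 + x $ i *s y else axis i 1) = 1 + (\<Sum>i\<in>S. x $ i * y $ i)"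
    for S
    using finite[of S]
  proof (induction S rule: finite_induct)
    case empty
    have "(\<chi> i. axis i 1) = (mat 1 :: 'a^'n^'n)"
      by (vector mat_def axis_def)
    then show ?case by simp
  next
    case (insert l S)
    let ?R = "\<lambda>i. if i \<in> S then axis i 1 + x $ i *s y else axis i 1"
    have "(\<chi> i. if i \<in> insert l S then axis i 1 + x $ i *s y else axis i 1)
        = (\<chi> i. if i = l then axis i 1 + x $ i *s y else ?R i)"
      by (auto simp: vec_eq_iff)
    moreover have "(\<chi> i. if i = l then axis i 1 else ?R i) = (\<chi> i. ?R i)"
      using insert by (auto simp: vec_eq_iff)
    moreover have "det (\<chi> i. if i = l then x $ i *s y else ?R i)
        = x $ l * det (\<chi> i. if i = l then y else ?R i)"
      using det_row_mul[of l "x $ l" "\<lambda>_. y" ?R] by (simp cong: if_cong)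
    ultimately show ?case
      using insert det_identity_replace_row[of S l y "\<lambda>i. x $ i"]
        det_row_add[of l "\<lambda>i. axis i 1" "\<lambda>i. x $ i *s y" ?R]
      by (simp add: add.commute)
  qed
  from this[of UNIV] show ?thesis by simp
qed

text \<open>If M x = u, then M + u y^T = M (I + x y^T). The form with a given solution
  \<open>x\<close> replaces the inverse of \<open>M\<close>, since the solutions used later are
  written down explicitly.\<close>

lemma det_plus_rank_one:
  fixes M :: "'a::field^'n::finite^'n"
  assumes "M *v x = u"
  shows "det (\<chi> i j. M $ i $ j + u $ i * y $ j) = det M * (1 + (\<Sum>i\<in>UNIV. x $ i * y $ i))"
proof -
  have "(\<chi> i j. M $ i $ j + u $ i * y $ j) = M ** (\<chi> i. axis i 1 + x $ i *s y)"
    unfolding assms[symmetric]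
    by (simp add: vec_eq_iff matrix_matrix_mult_def matrix_vector_mult_def axis_def
        distrib_left sum.distrib sum_distrib_right mult.assoc if_distrib[where f = "\<lambda>z. _ * z"] cong: if_cong)
  then show ?thesis
    by (simp add: det_mul det_identity_plus_rank_one)
qed

text \<open>By orthogonality the updates already made annihilate \<open>x l\<close>, so
  \<open>x l\<close> still solves the updated system for \<open>u l\<close> and each new update
  contributes its own independent factor.\<close>

lemma det_plus_orthogonal_rank_ones:
  fixes M :: "'a::field^'n::finite^'n"
  assumes "finite I" "\<And>i. i \<in> I \<Longrightarrow> M *v x i = u i"
    and "\<And>i j. i \<in> I \<Longrightarrow> j \<in> I \<Longrightarrow> i \<noteq> j \<Longrightarrow> (\<Sum>v\<in>UNIV. x i $ v * y j $ v) = 0"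
  shows "det (\<chi> a b. M $ a $ b + (\<Sum>i\<in>I. u i $ a * y i $ b))
       = det M * (\<Prod>i\<in>I. 1 + (\<Sum>v\<in>UNIV. x i $ v * y i $ v))"
  using assms
proof (induction I rule: finite_induct)
  case empty
  then show ?case by simp
next
  case (insert l I)
  let ?M = "\<chi> a b. M $ a $ b + (\<Sum>i\<in>I. u i $ a * y i $ b)"
  have "(\<Sum>b\<in>UNIV. (\<Sum>i\<in>I. u i $ a * y i $ b) * x l $ b) = 0" for a
  proof -
    have "(\<Sum>b\<in>UNIV. (\<Sum>i\<in>I. u i $ a * y i $ b) * x l $ b)
        = (\<Sum>i\<in>I. u i $ a * (\<Sum>b\<in>UNIV. x l $ b * y i $ b))"
      unfolding sum_distrib_right sum_distrib_left by (subst sum.swap) (simp add: mult_ac)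
    also have "\<dots> = 0"
      using insert by (intro sum.neutral) auto
    finally show ?thesis .
  qed
  then have "?M *v x l = M *v x l"
    by (simp add: vec_eq_iff matrix_vector_mult_def distrib_right sum.distrib)
  then have "?M *v x l = u l"
    using insert by simp
  from det_plus_rank_one[OF this, of "y l"] show ?case
    using insert by (simp add: add_ac mult_ac)
qed

section \<open>Determinants of matrices split along fibres with negative cliques\<close>

lemma one_minus_double_neq_0: "1 - 2 * real t \<noteq> 0"
proof
  assume "1 - 2 * real t = 0"
  then have "real (2 * t) = real 1" by simp
  then have "2 * t = 1" by (simp only: of_nat_eq_iff)
  then show False by presburger
qed

text \<open>The matrix is a diagonal \<open>M0\<close>, minus twice 1_c 1_c^T for each clique c,
  plus 1_F 1_F^T for each fibre F. Both families of updates are orthogonal. Each clique contributes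
  a factor 1 - 2r, and each fibre a factor that depends only on its size and on the number of its
  clique vertices.\<close>

lemma det_cliquewise_signed:
  fixes \<phi> :: "'v::finite \<Rightarrow> 'i" and C :: "'i \<Rightarrow> nat \<Rightarrow> 'v set"
  assumes K: "finite K" "\<And>v. \<phi> v \<in> K"
    and C_fibre: "\<And>i j. i \<in> K \<Longrightarrow> j \<in> {1..m i} \<Longrightarrow> C i j \<subseteq> {v. \<phi> v = i}"
    and C_card: "\<And>i j. i \<in> K \<Longrightarrow> j \<in> {1..m i} \<Longrightarrow> card (C i j) = r i"
    and C_disj: "\<And>i. i \<in> K \<Longrightarrow> disjoint_family_on (C i) {1..m i}"
  shows "det (\<chi> u v. if \<phi> v = \<phi> u \<and> u \<noteq> v
                then if \<exists>j\<in>{1..m (\<phi> u)}. u \<in> C (\<phi> u) j \<and> v \<in> C (\<phi> u) j then -1 else (1::real)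
                else 0)
    = (-1) ^ CARD('v) * (\<Prod>i\<in>K. (-1) ^ (m i * r i) * (1 - 2 * real (r i)) ^ m i *
        (1 - (real (card {v. \<phi> v = i}) - real (m i * r i)) + real (m i * r i) / (1 - 2 * real (r i))))"
proof -
  \<comment> \<open>The pairs (i, j) index all cliques of all fibres at once; \<open>Q\<close> is
    the set of all clique vertices.\<close>
  define I where "I = (SIGMA i:K. {1..m i})"
  define c where "c p = C (fst p) (snd p)" for p
  define Q where "Q = (\<Union>p\<in>I. c p)"
  have finI: "finite I"
    using K by (simp add: I_def)
  have c_fibre: "\<phi> v = fst p" if "p \<in> I" "v \<in> c p" for p v
    using that C_fibre by (fastforce simp: I_def c_def)
  have c_card: "card (c p) = r (fst p)" if "p \<in> I" for p
    using that C_card by (auto simp: I_def c_def)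
  have c_unique: "p = q" if pq: "p \<in> I" "q \<in> I" and v: "v \<in> c p" "v \<in> c q" for p q v
  proof -
    have "fst p = fst q"
      using c_fibre pq v by metis
    moreover have "snd p = snd q"
    proof (rule ccontr)
      assume "snd p \<noteq> snd q"
      then have "C (fst p) (snd p) \<inter> C (fst p) (snd q) = {}"
        using C_disj[of "fst p"] pq calculation
        by (intro disjoint_family_onD[of "C (fst p)" "{1..m (fst p)}"]) (auto simp: I_def)
      then show False
        using v calculation by (auto simp: c_def)
    qed
    ultimately show ?thesis
      by (simp add: prod_eq_iff)
  qed
  \<comment> \<open>The cliques are pairwise disjoint, so a sum over the cliques containing
    \<open>v\<close> has at most one term.\<close>
  have sum_at: "(\<Sum>p\<in>I. of_bool (v \<in> c p) * g p) = (g q :: real)" if "q \<in> I" "v \<in> c q" for q v g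
  proof -
    have "of_bool (v \<in> c p) * g p = (if p = q then g p else 0)" if "p \<in> I" for p
      using c_unique[OF that \<open>q \<in> I\<close> _ \<open>v \<in> c q\<close>] \<open>v \<in> c q\<close> by (cases "v \<in> c p") auto
    then show ?thesis
      using finI that by simp
  qed
  have sum_off: "(\<Sum>p\<in>I. of_bool (v \<in> c p) * g p) = (0 :: real)" if "v \<notin> Q" for v g
    using that by (intro sum.neutral) (auto simp: Q_def)
  have Q_fibre: "card (Q \<inter> {v. \<phi> v = i}) = m i * r i" if "i \<in> K" for i
  proof -
    have "Q \<inter> {v. \<phi> v = i} = (\<Union>j\<in>{1..m i}. C i j)"
      using that c_fibre C_fibre by (fastforce simp: Q_def I_def c_def)
    also have "card \<dots> = (\<Sum>j\<in>{1..m i}. card (C i j))"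
      using C_disj[OF that] by (intro card_UN_disjoint) (auto simp: disjoint_family_on_def)
    also have "\<dots> = m i * r i"
      using that C_card by simp
    finally show ?thesis .
  qed
  \<comment> \<open>The signs are chosen so that the final diagonal is zero: 1 - 2 + 1 at a clique
    vertex and -1 + 0 + 1 elsewhere.\<close>
  define M0 :: "real^'v^'v" where "M0 = (\<chi> a b. if a = b then if a \<in> Q then 1 else -1 else 0)"
  define M1 where "M1 = (\<chi> a b. M0 $ a $ b + (\<Sum>p\<in>I. of_bool (a \<in> c p) * (-2 * of_bool (b \<in> c p))))"
  \<comment> \<open>The solution of \<open>M1 *v x i\<close> = indicator of fibre \<open>i\<close>:
    \<open>M1\<close> multiplies the indicator of a clique by 1 - 2r and acts as -1 at vertices
    outside all cliques.\<close>
  define x where "x i = (\<chi> v. if \<phi> v = i then if v \<in> Q then 1 / (1 - 2 * real (r i)) else -1 else 0)" for i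

  have "card Q = (\<Sum>i\<in>K. card (Q \<inter> {v. \<phi> v = i}))"
  proof -
    have "Q = (\<Union>i\<in>K. Q \<inter> {v. \<phi> v = i})" using K by auto
    then show ?thesis
      using K card_UN_disjoint[of K "\<lambda>i. Q \<inter> {v. \<phi> v = i}"] by auto
  qed
  then have cardQ: "card Q = (\<Sum>i\<in>K. m i * r i)"
    using Q_fibre by simp
  have "det M0 = (\<Prod>a\<in>UNIV. M0 $ a $ a)"
    by (rule det_diagonal) (simp add: M0_def)
  \<comment> \<open>Taking -1 out of every diagonal entry leaves a -1 exactly at the vertices of
    \<open>Q\<close>, which separates the global sign from the signs of the fibres.\<close>
  also have "\<dots> = (\<Prod>a\<in>UNIV. (-1) * (if a \<in> Q then -1 else 1))"
    by (intro prod.cong) (auto simp: M0_def)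
  also have "\<dots> = (-1) ^ CARD('v) * (-1) ^ card Q"
    by (subst prod.distrib) (simp add: prod.If_cases)
  finally have det0: "det M0 = (-1) ^ CARD('v) * (\<Prod>i\<in>K. (-1) ^ (m i * r i))"
    by (simp add: cardQ power_sum)

  have "det M1 = det M0 * (\<Prod>p\<in>I. 1 + (\<Sum>v\<in>UNIV. of_bool (v \<in> c p) * (-2 * of_bool (v \<in> c p))))"
  proof -
    \<comment> \<open>Cliques lie in \<open>Q\<close>, where \<open>M0\<close> acts as the identity,
      so each clique indicator is its own solution vector.\<close>
    have "M0 *v (\<chi> v. of_bool (v \<in> c p)) = (\<chi> v. of_bool (v \<in> c p))" if "p \<in> I" for p
      using that by (auto simp: vec_eq_iff matrix_vector_mult_def M0_def Q_def if_distrib[where f = "\<lambda>z. z * _"] cong: if_cong)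
    moreover have "(\<Sum>v\<in>UNIV. of_bool (v \<in> c p) * (-2 * of_bool (v \<in> c q))) = (0::real)"
      if "p \<in> I" "q \<in> I" "p \<noteq> q" for p q
    proof (intro sum.neutral ballI)
      fix v
      show "of_bool (v \<in> c p) * (-2 * of_bool (v \<in> c q)) = (0::real)"
        using c_unique[OF that(1,2), of v] that(3) by (cases "v \<in> c p") auto
    qed
    ultimately show ?thesis
      using det_plus_orthogonal_rank_ones[of I M0 "\<lambda>p. \<chi> v. of_bool (v \<in> c p)" "\<lambda>p. \<chi> v. of_bool (v \<in> c p)"
          "\<lambda>p. \<chi> v. -2 * of_bool (v \<in> c p)"] finI
      by (simp add: M1_def)
  qed
  also have "(\<Prod>p\<in>I. 1 + (\<Sum>v\<in>UNIV. of_bool (v \<in> c p) * (-2 * of_bool (v \<in> c p))))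
      = (\<Prod>p\<in>I. 1 - 2 * real (r (fst p)))"
  proof (intro prod.cong refl)
    fix p assume "p \<in> I"
    have "(\<Sum>v\<in>UNIV. of_bool (v \<in> c p) * (-2 * of_bool (v \<in> c p))) = (\<Sum>v\<in>UNIV. -2 * of_bool (v \<in> c p) :: real)"
      by (intro sum.cong) auto
    also have "\<dots> = -2 * real (card (c p))"
      by (subst sum_mult_of_bool_eq) auto
    finally show "1 + (\<Sum>v\<in>UNIV. of_bool (v \<in> c p) * (-2 * of_bool (v \<in> c p))) = 1 - 2 * real (r (fst p))"
      using c_card[OF \<open>p \<in> I\<close>] by simp
  qed
  also have "\<dots> = (\<Prod>i\<in>K. (1 - 2 * real (r i)) ^ m i)"
    using K prod.Sigma[of K "\<lambda>i. {1..m i}" "\<lambda>i j. 1 - 2 * real (r i)"]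
    by (simp add: I_def case_prod_unfold)
  finally have det1: "det M1 = (-1) ^ CARD('v) * (\<Prod>i\<in>K. (-1) ^ (m i * r i) * (1 - 2 * real (r i)) ^ m i)"
    by (simp add: det0 prod.distrib)

  have M1x: "M1 *v x i = (\<chi> v. of_bool (\<phi> v = i))" if "i \<in> K" for i
  proof -
    have sum_c: "(\<Sum>b\<in>c p. x i $ b) = (if fst p = i then real (r i) / (1 - 2 * real (r i)) else 0)" if "p \<in> I" for p
    proof -
      have "x i $ b = (if fst p = i then 1 / (1 - 2 * real (r i)) else 0)" if "b \<in> c p" for b
        using c_fibre[OF \<open>p \<in> I\<close> that] \<open>p \<in> I\<close> that by (auto simp: x_def Q_def)
      then show ?thesis
        using c_card[OF \<open>p \<in> I\<close>] by simp
    qed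
    have "(M1 *v x i) $ a = of_bool (\<phi> a = i)" for a
    proof -
      have "(M1 *v x i) $ a = (\<Sum>b\<in>UNIV. M0 $ a $ b * x i $ b)
          + (\<Sum>b\<in>UNIV. (\<Sum>p\<in>I. of_bool (a \<in> c p) * (-2 * of_bool (b \<in> c p))) * x i $ b)"
        by (simp add: matrix_vector_mult_def M1_def distrib_right sum.distrib)
      also have "(\<Sum>b\<in>UNIV. M0 $ a $ b * x i $ b) = (if a \<in> Q then 1 else -1) * x i $ a"
        by (simp add: M0_def if_distrib[where f = "\<lambda>z. z * _"] cong: if_cong)
      also have "(\<Sum>b\<in>UNIV. (\<Sum>p\<in>I. of_bool (a \<in> c p) * (-2 * of_bool (b \<in> c p))) * x i $ b)
          = (\<Sum>p\<in>I. of_bool (a \<in> c p) * (-2 * (\<Sum>b\<in>c p. x i $ b)))"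
      proof -
        have "(\<Sum>b\<in>c p. x i $ b) = (\<Sum>b\<in>UNIV. of_bool (b \<in> c p) * x i $ b)" for p
          by (simp add: sum_of_bool_mult_eq)
        then show ?thesis
          unfolding sum_distrib_right by (subst sum.swap) (simp only: sum_distrib_left mult.assoc)
      qed
      also have "(if a \<in> Q then 1 else -1) * x i $ a + \<dots> = of_bool (\<phi> a = i)"
      proof (cases "a \<in> Q")
        case True
        then obtain p where p: "p \<in> I" "a \<in> c p" by (auto simp: Q_def)
        then have "\<phi> a = fst p" by (rule c_fibre)
        then show ?thesis
          using True one_minus_double_neq_0[of "r i"] unfolding sum_at[OF p] sum_c[OF p(1)]
          by (simp add: x_def field_simps)
      next
        case False
        then show ?thesis
          unfolding sum_off[OF False] by (simp add: x_def)
      qed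
      finally show ?thesis .
    qed
    then show ?thesis
      by (simp add: vec_eq_iff)
  qed
  let ?N = "\<chi> a b. M1 $ a $ b + (\<Sum>i\<in>K. of_bool (\<phi> a = i) * of_bool (\<phi> b = i))"
  have "det ?N = det M1 * (\<Prod>i\<in>K. 1 + (\<Sum>v\<in>UNIV. x i $ v * of_bool (\<phi> v = i)))"
  proof -
    have "(\<Sum>v\<in>UNIV. x i $ v * of_bool (\<phi> v = j)) = (0::real)" if "i \<noteq> j" for i j
      using that by (intro sum.neutral) (auto simp: x_def)
    then show ?thesis
      using det_plus_orthogonal_rank_ones[of K M1 x "\<lambda>i. \<chi> v. of_bool (\<phi> v = i)" "\<lambda>i. \<chi> v. of_bool (\<phi> v = i)"]
        K M1x by simp
  qed
  also have "(\<Prod>i\<in>K. 1 + (\<Sum>v\<in>UNIV. x i $ v * of_bool (\<phi> v = i)))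
      = (\<Prod>i\<in>K. 1 - (real (card {v. \<phi> v = i}) - real (m i * r i)) + real (m i * r i) / (1 - 2 * real (r i)))"
  proof (intro prod.cong refl)
    fix i assume i: "i \<in> K"
    let ?F = "{v. \<phi> v = i}"
    \<comment> \<open>Of the vertices of the fibre, the \<open>m i * r i\<close> in cliques
      contribute 1 / (1 - 2r) each, the others -1 each.\<close>
    have "(\<Sum>v\<in>UNIV. x i $ v * of_bool (\<phi> v = i)) = (\<Sum>v\<in>?F. x i $ v)"
      by (simp add: sum_mult_of_bool_eq)
    also have "\<dots> = (\<Sum>v\<in>?F. if v \<in> Q then 1 / (1 - 2 * real (r i)) else -1)"
      by (intro sum.cong) (auto simp: x_def)
    also have "\<dots> = real (card (Q \<inter> ?F)) / (1 - 2 * real (r i)) - real (card (?F - Q))"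
      by (simp add: sum.If_cases Int_commute Diff_eq)
    also have "real (card (?F - Q)) = real (card ?F) - real (card (Q \<inter> ?F))"
      by (simp add: card_Diff_subset_Int Int_commute of_nat_diff card_mono)
    finally show "1 + (\<Sum>v\<in>UNIV. x i $ v * of_bool (\<phi> v = i))
        = 1 - (real (card ?F) - real (m i * r i)) + real (m i * r i) / (1 - 2 * real (r i))"
      by (simp add: Q_fibre[OF i])
  qed
  also have "?N = (\<chi> u v. if \<phi> v = \<phi> u \<and> u \<noteq> v
                then if \<exists>j\<in>{1..m (\<phi> u)}. u \<in> C (\<phi> u) j \<and> v \<in> C (\<phi> u) j then -1 else 1
                else 0)"
  proof -
    have "?N $ a $ b = (if \<phi> b = \<phi> a \<and> a \<noteq> b
                then if \<exists>j\<in>{1..m (\<phi> a)}. a \<in> C (\<phi> a) j \<and> b \<in> C (\<phi> a) j then -1 else 1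
                else 0)" for a b
    proof -
      have fib: "(\<Sum>i\<in>K. of_bool (\<phi> a = i) * of_bool (\<phi> b = i)) = (of_bool (\<phi> b = \<phi> a) :: real)"
      proof -
        have "(\<Sum>i\<in>K. of_bool (\<phi> a = i) * of_bool (\<phi> b = i))
            = (\<Sum>i\<in>{\<phi> a}. of_bool (\<phi> a = i) * of_bool (\<phi> b = i) :: real)"
          using K by (intro sum.mono_neutral_right) auto
        then show ?thesis by simp
      qed
      have N: "?N $ a $ b = M0 $ a $ b + (\<Sum>p\<in>I. of_bool (a \<in> c p) * (-2 * of_bool (b \<in> c p)))
          + of_bool (\<phi> b = \<phi> a)"
        by (simp only: M1_def fib vec_lambda_beta)
      show ?thesis
      proof (cases "a \<in> Q")
        case True
        then obtain p where p: "p \<in> I" "a \<in> c p" by (auto simp: Q_def)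
        have pa: "\<phi> a = fst p" using p by (rule c_fibre)
        have same: "b \<in> c p \<longleftrightarrow> (\<exists>j\<in>{1..m (\<phi> a)}. a \<in> C (\<phi> a) j \<and> b \<in> C (\<phi> a) j)"
        proof
          assume "b \<in> c p"
          then show "\<exists>j\<in>{1..m (\<phi> a)}. a \<in> C (\<phi> a) j \<and> b \<in> C (\<phi> a) j"
            using p pa by (auto simp: c_def I_def intro!: bexI[of _ "snd p"])
        next
          assume "\<exists>j\<in>{1..m (\<phi> a)}. a \<in> C (\<phi> a) j \<and> b \<in> C (\<phi> a) j"
          then obtain j where j: "(\<phi> a, j) \<in> I" "a \<in> c (\<phi> a, j)" "b \<in> c (\<phi> a, j)"
            using K by (auto simp: I_def c_def)
          then show "b \<in> c p"
            using c_unique[OF p(1) j(1) p(2) j(2)] by simp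
        qed
        have fibre: "\<phi> b = \<phi> a" if "b \<in> c p"
          using c_fibre[OF p(1) that] pa by simp
        show ?thesis
          unfolding N sum_at[OF p] same[symmetric] using True p fibre
          by (cases "b \<in> c p") (auto simp: M0_def)
      next
        case False
        then have "\<not> (\<exists>j\<in>{1..m (\<phi> a)}. a \<in> C (\<phi> a) j \<and> b \<in> C (\<phi> a) j)"
          using K by (auto simp: Q_def I_def c_def)
        then show ?thesis
          using False unfolding N sum_off[OF False] by (auto simp: M0_def)
      qed
    qed
    then show ?thesis
      by (simp add: vec_eq_iff)
  qed
  finally show ?thesis
    by (simp add: det1 prod.distrib mult_ac)
qed

section \<open>Hall's theorem\<close>

text \<open>Induction on the size of the index set. Either some nonempty proper \<open>J\<close> is
  tight, and \<open>J\<close> and its complement are matched separately, or every nonempty proper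
  subset has a surplus, and any one choice for any one index can be removed.\<close>

theorem hall_marriage:
  assumes "finite I" "\<And>i. i \<in> I \<Longrightarrow> finite (A i)"
    and "\<And>J. J \<subseteq> I \<Longrightarrow> card J \<le> card (\<Union>i\<in>J. A i)"
  shows "\<exists>f. inj_on f I \<and> (\<forall>i\<in>I. f i \<in> A i)"
  using assms
proof (induction "card I" arbitrary: I A rule: less_induct)
  case less
  note fin = less.prems(1) and finA = less.prems(2) and hall = less.prems(3)
  have finU: "finite (\<Union>i\<in>J. A i)" if "J \<subseteq> I" for J
    using finite_subset[OF that fin] finA that by blast
  show ?case
  proof (cases "\<exists>J. J \<subseteq> I \<and> J \<noteq> {} \<and> J \<noteq> I \<and> card (\<Union>i\<in>J. A i) \<le> card J")
    case True
    then obtain J where J: "J \<subseteq> I" "J \<noteq> {}" "J \<noteq> I" and tight: "card (\<Union>i\<in>J. A i) \<le> card J"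
      by blast
    let ?U = "\<Union>i\<in>J. A i"
    have finJ: "finite J" using J fin finite_subset by blast
    have "card J < card I" using J fin by (simp add: psubset_card_mono psubset_eq)
    then have "\<exists>f. inj_on f J \<and> (\<forall>i\<in>J. f i \<in> A i)"
      using J finJ finA hall by (intro less.hyps) auto
    then obtain f where f: "inj_on f J" "\<forall>i\<in>J. f i \<in> A i" by blast
    have "card (I - J) < card I"
      using J fin finJ by (intro psubset_card_mono) auto
    \<comment> \<open>Hall's condition survives outside \<open>?U\<close>: apply it to
      \<open>K \<union> J\<close> and cancel the tight part \<open>J\<close>.\<close>
    moreover have "card K \<le> card (\<Union>i\<in>K. A i - ?U)" if K: "K \<subseteq> I - J" for K
    proof -
      have finK: "finite K" using K fin finite_subset by blast
      have "card K + card J = card (K \<union> J)"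
        using K finK finJ by (subst card_Un_disjoint) auto
      also have "\<dots> \<le> card (\<Union>i\<in>K \<union> J. A i)"
        using K J by (intro hall) auto
      also have "(\<Union>i\<in>K \<union> J. A i) = (\<Union>i\<in>K. A i - ?U) \<union> ?U"
        by auto
      also have "card \<dots> \<le> card (\<Union>i\<in>K. A i - ?U) + card ?U"
        by (rule card_Un_le)
      finally show ?thesis using tight by simp
    qed
    ultimately have "\<exists>g. inj_on g (I - J) \<and> (\<forall>i\<in>I - J. g i \<in> A i - ?U)"
      using fin finA by (intro less.hyps) auto
    then obtain g where g: "inj_on g (I - J)" "\<forall>i\<in>I - J. g i \<in> A i - ?U" by blast
    let ?h = "\<lambda>i. if i \<in> J then f i else g i"
    have "inj_on ?h I"
    proof (rule inj_onI)
      fix a b assume ab: "a \<in> I" "b \<in> I" "?h a = ?h b"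
      have sep: "f x \<noteq> g y" if "x \<in> J" "y \<in> I - J" for x y
        using that f(2) g(2) by (metis DiffD2 UN_I)
      show "a = b"
        using ab inj_onD[OF f(1)] inj_onD[OF g(1)] sep by (metis DiffI)
    qed
    moreover have "\<forall>i\<in>I. ?h i \<in> A i"
      using f(2) g(2) by auto
    ultimately show ?thesis by blast
  next
    case False
    show ?thesis
    proof (cases "I = {}")
      case True
      then show ?thesis by simp
    next
      case ne: False
      then obtain l where l: "l \<in> I" by blast
      have "card {l} \<le> card (\<Union>i\<in>{l}. A i)" using l by (intro hall) simp
      then have "A l \<noteq> {}" by auto
      then obtain x where x: "x \<in> A l" by blast
      \<comment> \<open>Removing \<open>x\<close> costs at most one element, which the strict
        inequality for nonempty proper subsets covers.\<close>
      have "card J \<le> card (\<Union>i\<in>J. A i - {x})" if J: "J \<subseteq> I - {l}" for J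
      proof (cases "J = {}")
        case nonempty: False
        have "card J < card (\<Union>i\<in>J. A i)"
        proof (rule ccontr)
          assume "\<not> ?thesis"
          then have "J \<subseteq> I \<and> J \<noteq> {} \<and> J \<noteq> I \<and> card (\<Union>i\<in>J. A i) \<le> card J"
            using nonempty J l by auto
          with False show False by blast
        qed
        moreover have "card (\<Union>i\<in>J. A i) \<le> Suc (card ((\<Union>i\<in>J. A i) - {x}))"
          using card_Suc_Diff1[of "\<Union>i\<in>J. A i" x] finU[of J] J
          by (cases "x \<in> (\<Union>i\<in>J. A i)") auto
        moreover have "(\<Union>i\<in>J. A i - {x}) = (\<Union>i\<in>J. A i) - {x}" by auto
        ultimately show ?thesis by simp
      qed simp
      moreover have "card (I - {l}) < card I"
        using l fin by (rule card_Diff1_less[rotated])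
      ultimately have "\<exists>g. inj_on g (I - {l}) \<and> (\<forall>i\<in>I - {l}. g i \<in> A i - {x})"
        using fin finA by (intro less.hyps) auto
      then obtain g where g: "inj_on g (I - {l})" "\<forall>i\<in>I - {l}. g i \<in> A i - {x}" by blast
      have "inj_on (g(l := x)) I"
        using g by (auto simp: inj_on_def)
      moreover have "\<forall>i\<in>I. (g(l := x)) i \<in> A i"
        using g x by auto
      ultimately show ?thesis by blast
    qed
  qed
qed

text \<open>Apply Hall's theorem to \<open>\<alpha> i\<close> copies of each set \<open>A i\<close>.\<close>

lemma assignment_with_prescribed_fibres:
  fixes A :: "'i \<Rightarrow> ('v::finite) set"
  assumes I: "finite I" and total: "(\<Sum>i\<in>I. \<alpha> i) = CARD('v)"
    and bound: "\<And>S. S \<noteq> {} \<Longrightarrow> S \<subseteq> I \<Longrightarrow> (\<Sum>i\<in>S. \<alpha> i) \<le> card (\<Union>i\<in>S. A i)"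
  shows "\<exists>\<phi>. (\<forall>v. \<phi> v \<in> I \<and> v \<in> A (\<phi> v)) \<and> (\<forall>i\<in>I. card {v. \<phi> v = i} = \<alpha> i)"
proof -
  let ?T = "SIGMA i:I. {..<\<alpha> i}"
  \<comment> \<open>A set \<open>J\<close> of copies has at most as many elements as all copies of
    the indices occurring in it, so \<open>bound\<close> gives Hall's condition.\<close>
  have "card J \<le> card (\<Union>p\<in>J. A (fst p))" if J: "J \<subseteq> ?T" for J
  proof (cases "J = {}")
    case False
    have "fst ` J \<subseteq> I" using J by auto
    have "J \<subseteq> (SIGMA i:fst ` J. {..<\<alpha> i})" using J by force
    then have "card J \<le> card (SIGMA i:fst ` J. {..<\<alpha> i})"
      using I \<open>fst ` J \<subseteq> I\<close> by (intro card_mono) (auto intro: finite_subset)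
    also have "\<dots> = (\<Sum>i\<in>fst ` J. \<alpha> i)"
      using I \<open>fst ` J \<subseteq> I\<close> finite_subset by (subst card_SigmaI) auto
    also have "\<dots> \<le> card (\<Union>i\<in>fst ` J. A i)"
      using False \<open>fst ` J \<subseteq> I\<close> by (intro bound) auto
    finally show ?thesis by simp
  qed simp
  then have "\<exists>f. inj_on f ?T \<and> (\<forall>p\<in>?T. f p \<in> A (fst p))"
    using I by (intro hall_marriage) auto
  then obtain f where inj: "inj_on f ?T" and f: "\<And>p. p \<in> ?T \<Longrightarrow> f p \<in> A (fst p)"
    by blast
  \<comment> \<open>There are as many copies as vertices, so the injective matching is onto and
    every vertex receives a unique copy; \<open>\<phi>\<close> forgets which copy of the index it
    is.\<close>
  have "card (f ` ?T) = CARD('v)"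
    using I total by (simp add: card_image[OF inj])
  then have surj: "f ` ?T = UNIV"
    by (intro card_subset_eq) auto
  define \<phi> where "\<phi> v = fst (inv_into ?T f v)" for v
  have mem: "inv_into ?T f v \<in> ?T" for v
    using surj by (intro inv_into_into) simp
  have f_inv: "f (inv_into ?T f v) = v" for v
    using surj by (intro f_inv_into_f) simp
  have "\<phi> v \<in> I \<and> v \<in> A (\<phi> v)" for v
    using mem[of v] f[OF mem[of v]] f_inv[of v] by (auto simp: \<phi>_def)
  moreover have "card {v. \<phi> v = i} = \<alpha> i" if "i \<in> I" for i
  proof -
    have "{v. \<phi> v = i} = f ` ({i} \<times> {..<\<alpha> i})"
    proof (intro equalityI subsetI)
      fix v assume v: "v \<in> {v. \<phi> v = i}"
      have "inv_into ?T f v \<in> {i} \<times> {..<\<alpha> i}"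
        using v mem[of v] by (auto simp: \<phi>_def)
      then show "v \<in> f ` ({i} \<times> {..<\<alpha> i})"
        using f_inv[of v] by (metis imageI)
    next
      fix v assume "v \<in> f ` ({i} \<times> {..<\<alpha> i})"
      then obtain p where p: "p \<in> {i} \<times> {..<\<alpha> i}" "v = f p" by blast
      then have "p \<in> ?T" using that by auto
      then have "inv_into ?T f v = p"
        using inj p by simp
      then show "v \<in> {v. \<phi> v = i}"
        using p by (auto simp: \<phi>_def)
    qed
    moreover have "inj_on f ({i} \<times> {..<\<alpha> i})"
      by (rule inj_on_subset[OF inj]) (use that in auto)
    ultimately show ?thesis
      by (simp add: card_image)
  qed
  ultimately show ?thesis by blast
qed

section \<open>Block structure\<close>

lemma linked_refl [simp]: "linked G u u"
  by (simp add: linked_def)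

lemma linked_edge: "{u, v} \<in> edges G \<Longrightarrow> linked G u v"
  by (auto simp: linked_def)

lemma linked_trans: "linked G u v \<Longrightarrow> linked G v x \<Longrightarrow> linked G u x"
  by (simp add: linked_def)

lemma linked_sym: "linked G u v \<Longrightarrow> linked G v u"
  unfolding linked_def
  by (rule sympD[OF symp_rtranclp]) (auto intro: sympI simp: insert_commute)

lemma linked_mono: "linked G u v \<Longrightarrow> edges G \<subseteq> edges H \<Longrightarrow> linked H u v"
  unfolding linked_def by (rule rtranclp_mono[THEN predicate2D, rotated]) auto

text \<open>A connected graph has exactly one component, and the assumption leaves at most one after
  a deletion, so the number of components never rises.\<close>

lemma nonseparableI:
  assumes "connected_graph H"
    and "\<And>x u v. \<lbrakk>x \<in> verts H; u \<in> verts H - {x}; v \<in> verts H - {x}\<rbrakk> \<Longrightarrow> linked (delete_vertex H x) u v"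
  shows "nonseparable H"
proof -
  have "\<not> cut_vertex H x" for x
  proof
    assume cut: "cut_vertex H x"
    then have x: "x \<in> verts H" by (simp add: cut_vertex_def)
    have "graph_components H = {verts H}"
      using assms(1) by (auto simp: graph_components_def connected_graph_def)
    moreover have "graph_components (delete_vertex H x) \<subseteq> {verts H - {x}}"
      using assms(2)[OF x] by (auto simp: graph_components_def delete_vertex_def)
    then have "card (graph_components (delete_vertex H x)) \<le> card {verts H - {x}}"
      by (intro card_mono) auto
    ultimately show False
      using cut by (simp add: cut_vertex_def)
  qed
  then show ?thesis
    using assms(1) by (simp add: nonseparable_def)
qed

text \<open>Each component of \<open>G\<close> is the image under \<open>F\<close> of a component of
  \<open>G\<close> without \<open>v\<close>, and the different components of \<open>c\<close> and
  \<open>d\<close> have the same image because both vertices are adjacent to \<open>v\<close>. Hence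
  deletion strictly increases the number of components.\<close>

lemma cut_vertexI:
  assumes G: "simple_graph G" and edges: "{v, c} \<in> edges G" "{v, d} \<in> edges G"
    and sep: "\<not> linked (delete_vertex G v) c d"
  shows "cut_vertex G v"
proof -
  have ne: "v \<noteq> c" "v \<noteq> d" and in_G: "v \<in> verts G" "c \<in> verts G" "d \<in> verts G"
    using G edges by (fastforce simp: simple_graph_def)+
  define comp where "comp = (\<lambda>u. {x \<in> verts (delete_vertex G v). linked (delete_vertex G v) u x})"
  define F where "F = (\<lambda>K. {x \<in> verts G. \<exists>u\<in>K. linked G u x})"
  have sub: "linked G x y" if "linked (delete_vertex G v) x y" for x y
    using linked_mono[OF that] by (auto simp: delete_vertex_def)
  have F: "F (comp u) = {x \<in> verts G. linked G u x}" if "u \<in> verts G - {v}" for u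
  proof -
    have "u \<in> comp u"
      using that by (simp add: comp_def delete_vertex_def)
    moreover have "linked G u x" if "y \<in> comp u" "linked G y x" for x y
      using that by (auto simp: comp_def intro: linked_trans[of G u y x] sub)
    ultimately show ?thesis
      by (auto simp: F_def)
  qed
  have comp_ne: "comp u \<noteq> comp d" if "\<not> linked (delete_vertex G v) u d" for u
  proof
    assume "comp u = comp d"
    moreover have "d \<in> comp d"
      using ne in_G by (simp add: comp_def delete_vertex_def)
    ultimately have "d \<in> comp u"
      by simp
    then show False
      using that by (simp add: comp_def)
  qed
  have comps: "graph_components (delete_vertex G v) = comp ` (verts G - {v})"
    by (simp add: graph_components_def comp_def delete_vertex_def)
  have "graph_components G \<subseteq> F ` (comp ` (verts G - {v}) - {comp d})"
  proof
    fix K assume "K \<in> graph_components G"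
    then obtain u where u: "u \<in> verts G" and K: "K = {x \<in> verts G. linked G u x}"
      by (auto simp: graph_components_def)
    show "K \<in> F ` (comp ` (verts G - {v}) - {comp d})"
    \<comment> \<open>If \<open>u\<close> is \<open>v\<close> or is linked to \<open>d\<close>, its
      component in \<open>G\<close> also contains \<open>c\<close>, so \<open>comp c\<close>
      represents it in place of the omitted \<open>comp d\<close>.\<close>
    proof (cases "u = v \<or> linked (delete_vertex G v) u d")
      case True
      have vc: "linked G v c" and vd: "linked G v d"
        using edges by (auto intro: linked_edge)
      from True have "linked G u d"
        using vd sub by blast
      then have "linked G u c"
        using vc vd linked_trans linked_sym by metis
      then have "linked G u x \<longleftrightarrow> linked G c x" for x
        using linked_trans linked_sym by metis
      then have "K = F (comp c)"
        using F[of c] in_G ne K by auto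
      then show ?thesis
        using comp_ne[OF sep] in_G ne by blast
    next
      case False
      then have "K = F (comp u)" and "comp u \<noteq> comp d"
        using u K F comp_ne by auto
      then show ?thesis
        using False u by blast
    qed
  qed
  moreover have fin: "finite (comp ` (verts G - {v}))"
    using G by (simp add: simple_graph_def)
  ultimately have "card (graph_components G) \<le> card (comp ` (verts G - {v}) - {comp d})"
    by (meson surj_card_le finite_Diff)
  also have "\<dots> < card (comp ` (verts G - {v}))"
    using fin in_G ne by (intro card_Diff1_less) auto
  finally show ?thesis
    using in_G comps by (simp add: cut_vertex_def)
qed

text \<open>Among the nonseparable subgraphs containing \<open>H\<close>, one with the most vertices
  and edges in total is maximal; the total is bounded because the vertex type is finite.\<close>

lemma nonseparable_subgraph_in_block:
  fixes G :: "('v::finite) graph"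
  assumes "is_subgraph H G" "nonseparable H"
  obtains K where "is_block G K" "is_subgraph H K"
proof -
  let ?P = "\<lambda>K. is_subgraph K G \<and> nonseparable K \<and> is_subgraph H K"
  let ?m = "\<lambda>K :: 'v graph. card (verts K) + card (edges K)"
  have H: "?P H"
    using assms by (auto simp: is_subgraph_def)
  have "\<forall>K. ?P K \<longrightarrow> ?m K < Suc (CARD('v) + CARD('v set))"
    by (intro allI impI le_imp_less_Suc add_mono card_mono) auto
  from ex_has_greatest_nat[of ?P _ ?m, OF H this]
  obtain K where K: "?P K" and max: "\<And>L. ?P L \<Longrightarrow> ?m L \<le> ?m K"
    by (elim exE conjE) simp
  have "L = K" if L: "is_subgraph L G" "nonseparable L" "is_subgraph K L" for L
  proof -
    have sub: "verts K \<subseteq> verts L" "edges K \<subseteq> edges L"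
      using L by (auto simp: is_subgraph_def)
    have "?m L \<le> ?m K"
      using L K by (intro max) (auto simp: is_subgraph_def)
    then have "verts K = verts L" "edges K = edges L"
      using card_mono[OF finite sub(1)] card_mono[OF finite sub(2)]
      by (simp_all add: card_subset_eq sub)
    then show ?thesis by (simp add: prod_eq_iff)
  qed
  then show ?thesis
    using K by (intro that[of K]) (auto simp: is_block_def)
qed

text \<open>A walk of least length repeats no vertex, since the part between two visits to the same
  vertex could be cut out.\<close>

lemma shortest_path_inj:
  assumes "R\<^sup>*\<^sup>* a b"
  obtains n f where "f 0 = a" "f n = b" "\<And>i. i < n \<Longrightarrow> R (f i) (f (Suc i))" "inj_on f {..n}"
proof -
  define n where "n = (LEAST m. (R ^^ m) a b)"
  have n: "(R ^^ n) a b"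
    unfolding n_def by (rule LeastI_ex) (rule rtranclp_imp_relpowp[OF assms])
  have least: "n \<le> m" if "(R ^^ m) a b" for m
    unfolding n_def using that by (rule Least_le)
  obtain f where f: "f 0 = a" "f n = b" and step: "\<forall>i<n. R (f i) (f (Suc i))"
    using n unfolding relpowp_fun_conv by blast
  have seg: "(R ^^ d) (f s) (f (s + d))" if "s + d \<le> n" for s d
    using that by (induction d) (use step in \<open>auto intro!: relcomppI\<close>)
  have "inj_on f {..n}"
  proof (rule linorder_inj_onI')
    fix i j assume ij: "i \<in> {..n}" "j \<in> {..n}" "i < j"
    show "f i \<noteq> f j"
    proof
      assume eq: "f i = f j"
      have "(R ^^ i) a (f i)" "(R ^^ (n - j)) (f j) b"
        using seg[of 0 i] seg[of j "n - j"] ij f by auto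
      then have "(R ^^ (i + (n - j))) a b"
        unfolding relpowp_add eq by auto
      from least[OF this] ij show False by simp
    qed
  qed
  then show ?thesis using that f step by blast
qed

section \<open>Graphs all of whose blocks are complete\<close>

locale block_graph =
  fixes G :: "('v::finite) graph" and k :: nat and B :: "nat \<Rightarrow> 'v graph"
  assumes simple: "simple_graph G"
    and blocks: "bij_betw B {1..k} {H. is_block G H}"
    and block_complete: "is_block G H \<Longrightarrow> complete_graph H"
begin

abbreviation X :: "nat \<Rightarrow> 'v set" where "X i \<equiv> verts (B i)"

lemma is_block_B: "i \<in> {1..k} \<Longrightarrow> is_block G (B i)"
  using blocks by (auto simp: bij_betw_def)

text \<open>Completeness makes the vertex set of a block determine its edges, so later arguments can
  work with the sets \<open>X i\<close>.\<close>

lemma block_edge_iff: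
  assumes "i \<in> {1..k}"
  shows "{u, v} \<in> edges (B i) \<longleftrightarrow> u \<in> X i \<and> v \<in> X i \<and> u \<noteq> v"
proof
  assume e: "{u, v} \<in> edges (B i)"
  have "simple_graph (B i)"
    using is_block_B[OF assms] by (simp add: is_block_def is_subgraph_def)
  then have "{u, v} \<subseteq> X i" "card {u, v} = 2"
    using e unfolding simple_graph_def by blast+
  then show "u \<in> X i \<and> v \<in> X i \<and> u \<noteq> v"
    by (auto simp: card_2_iff)
next
  assume "u \<in> X i \<and> v \<in> X i \<and> u \<noteq> v"
  then show "{u, v} \<in> edges (B i)"
    using block_complete[OF is_block_B[OF assms]] by (simp add: complete_graph_def)
qed

lemma block_edges_subset: "i \<in> {1..k} \<Longrightarrow> edges (B i) \<subseteq> edges G"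
  using is_block_B[of i] by (auto simp: is_block_def is_subgraph_def)

lemma edge_ne: "{u, v} \<in> edges G \<Longrightarrow> u \<noteq> v"
  using simple unfolding simple_graph_def by (auto dest!: bspec)

text \<open>A single edge with its two ends is nonseparable, hence contained in a maximal
  nonseparable subgraph.\<close>

lemma edge_in_some_block:
  assumes "{u, v} \<in> edges G"
  shows "\<exists>i\<in>{1..k}. u \<in> X i \<and> v \<in> X i"
proof -
  let ?H = "({u, v}, {{u, v}})"
  have sub: "is_subgraph ?H G"
    using assms simple by (auto simp: is_subgraph_def simple_graph_def)
  have "linked ?H u v" "linked ?H v u"
    by (auto intro!: linked_edge simp: insert_commute)
  then have "nonseparable ?H"
    by (intro nonseparableI) (auto simp: connected_graph_def)
  then obtain K where "is_block G K" "is_subgraph ?H K"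
    using nonseparable_subgraph_in_block[OF sub] by blast
  then have "K \<in> B ` {1..k}"
    using bij_betw_imp_surj_on[OF blocks] by simp
  then obtain i where "i \<in> {1..k}" "B i = K"
    by blast
  then show ?thesis
    using \<open>is_subgraph ?H K\<close> by (auto simp: is_subgraph_def)
qed

text \<open>Between complete graphs, inclusion of vertex sets gives inclusion of edges, which
  maximality rules out for distinct blocks.\<close>

lemma block_not_subset:
  assumes "i \<in> {1..k}" "j \<in> {1..k}" "i \<noteq> j"
  shows "\<exists>c. c \<in> X i \<and> c \<notin> X j"
proof (rule ccontr)
  assume "\<not> ?thesis"
  then have sub: "X i \<subseteq> X j" by auto
  have "edges (B i) \<subseteq> edges (B j)"
  proof
    fix e assume e: "e \<in> edges (B i)"
    then obtain u v where "e = {u, v}"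
      using is_block_B[OF assms(1)]
      by (auto simp: is_block_def is_subgraph_def simple_graph_def card_2_iff)
    then show "e \<in> edges (B j)"
      using e sub block_edge_iff assms by auto
  qed
  then have "B j = B i"
    using sub is_block_B[OF assms(1)] is_block_B[OF assms(2)]
    unfolding is_block_def is_subgraph_def by blast
  then show False
    using assms inj_onD[OF bij_betw_imp_inj_on[OF blocks]] by blast
qed

text \<open>A path that leaves a block and returns to it at another vertex could be added to the
  block without creating a cut-vertex.\<close>

lemma block_not_linked_outside:
  assumes i: "i \<in> {1..k}" and ab: "a \<in> X i" "b \<in> X i" "a \<noteq> b"
  shows "\<not> (\<lambda>u v. {u, v} \<in> edges G - edges (B i))\<^sup>*\<^sup>* a b"
proof
  assume "(\<lambda>u v. {u, v} \<in> edges G - edges (B i))\<^sup>*\<^sup>* a b"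
  then obtain n f where f: "f 0 = a" "f n = b"
    and step: "\<And>s. s < n \<Longrightarrow> {f s, f (Suc s)} \<in> edges G - edges (B i)"
    and inj: "inj_on f {..n}"
    by (rule shortest_path_inj) blast
  \<comment> \<open>The block with the returning path attached as an ear; the aim is that
    \<open>H\<close> is nonseparable.\<close>
  define H where "H = (X i \<union> f ` {..n}, edges (B i) \<union> (\<lambda>s. {f s, f (Suc s)}) ` {..<n})"
  have blk: "is_subgraph (B i) G"
    using is_block_B[OF i] by (simp add: is_block_def)
  have f_in: "f s \<in> verts G" if "s \<le> n" for s
  proof (cases s)
    case 0
    then show ?thesis using f ab blk by (auto simp: is_subgraph_def)
  next
    case (Suc t)
    then have "{f t, f s} \<in> edges G" using step[of t] that by simp
    then show ?thesis using simple by (auto simp: simple_graph_def)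
  qed
  have "simple_graph H"
    using blk simple step
    by (auto simp: H_def is_subgraph_def simple_graph_def)
  then have sub: "is_subgraph H G"
    using blk simple step f_in by (auto simp: H_def is_subgraph_def simple_graph_def)
  have up: "linked (delete_vertex H x) (f s) (f t)"
    if "s \<le> t" "t \<le> n" "x \<notin> f ` {s..t}" for s t x
    using that
  proof (induction "t - s" arbitrary: t)
    case 0
    then show ?case by simp
  next
    case (Suc d)
    then obtain t' where t: "t = Suc t'" by (cases t) auto
    have "linked (delete_vertex H x) (f s) (f t')"
      using Suc t by (intro Suc.hyps) auto
    moreover have "{f t', f t} \<in> edges (delete_vertex H x)"
      using Suc t by (auto simp: delete_vertex_def H_def)
    ultimately show ?case
      using linked_trans linked_edge by metis
  qed
  have inside: "linked (delete_vertex H x) u v" if "u \<in> X i - {x}" "v \<in> X i - {x}" for u v x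
  proof (cases "u = v")
    case False
    then have "{u, v} \<in> edges (delete_vertex H x)"
      using that block_edge_iff[OF i] by (auto simp: delete_vertex_def H_def)
    then show ?thesis by (rule linked_edge)
  qed simp
  \<comment> \<open>The path has no repeated vertex, so a deleted \<open>x\<close> blocks at most
    one direction from \<open>u\<close>; the other leads to the end \<open>a\<close> or
    \<open>b\<close> in the block.\<close>
  have to_block: "\<exists>c \<in> X i - {x}. linked (delete_vertex H x) c u" if u: "u \<in> verts H - {x}" for u x
  proof (cases "u \<in> X i")
    case False
    then obtain s where s: "s \<le> n" "u = f s"
      using u by (auto simp: H_def)
    show ?thesis
    proof (cases "x \<in> f ` {0..s}")
      case True
      then have "x \<notin> f ` {s..n}"
        using inj s u by (auto simp: inj_on_def) (metis atMost_iff le_trans order_antisym)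
      then have "linked (delete_vertex H x) b u" "b \<noteq> x"
        using up[of s n x] s f by (auto intro: linked_sym)
      then show ?thesis using ab by blast
    next
      case False
      then have "linked (delete_vertex H x) a u" "a \<noteq> x"
        using up[of 0 s x] s f by auto
      then show ?thesis using ab by blast
    qed
  next
    case True
    then show ?thesis using u by (intro bexI[of _ u]) auto
  qed
  have link: "linked (delete_vertex H x) u v"
    if u: "u \<in> verts H - {x}" and v: "v \<in> verts H - {x}" for u v x
  proof -
    obtain c d where cd: "c \<in> X i - {x}" "d \<in> X i - {x}"
      and "linked (delete_vertex H x) c u" "linked (delete_vertex H x) d v"
      using to_block[OF u] to_block[OF v] by blast
    then show ?thesis
      using inside[OF cd] linked_trans linked_sym by metis
  qed
  have "linked H u v" if uv: "u \<in> verts H" "v \<in> verts H" for u v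
  \<comment> \<open>Connectedness of \<open>H\<close> is read off from a deletion of some third
    \<open>x\<close>. If there is none, then \<open>u\<close> and \<open>v\<close> exhaust the
    vertex type, so either they coincide or they are \<open>a\<close> and \<open>b\<close>.\<close>
  proof (cases "\<exists>x. u \<noteq> x \<and> v \<noteq> x")
    case True
    then obtain x where "u \<noteq> x" "v \<noteq> x" by blast
    then have "u \<in> verts H - {x}" "v \<in> verts H - {x}" using uv by simp_all
    from link[OF this] show ?thesis
      by (rule linked_mono) (auto simp: delete_vertex_def)
  next
    case False
    then have "u = v \<or> u \<in> X i \<and> v \<in> X i" using ab by metis
    then show ?thesis
      using block_edge_iff[OF i, of u v] by (cases "u = v") (auto simp: H_def intro!: linked_edge)
  qed
  then have "nonseparable H"
    using link ab by (intro nonseparableI) (auto simp: connected_graph_def H_def)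
  moreover have "is_subgraph (B i) H"
    using blk by (auto simp: is_subgraph_def H_def)
  \<comment> \<open>Maximality of the block absorbs the ear, yet the first edge of the path lies
    outside the block.\<close>
  ultimately have "H = B i"
    using is_block_B[OF i] sub unfolding is_block_def by blast
  moreover have "0 < n"
    using f ab by (cases n) auto
  then have "{f 0, f (Suc 0)} \<in> edges H"
    by (auto simp: H_def)
  ultimately have "{f 0, f (Suc 0)} \<in> edges (B i)"
    by simp
  then show False
    using step[OF \<open>0 < n\<close>] by blast
qed

text \<open>If two blocks shared \<open>a\<close> and \<open>b\<close>, a vertex \<open>c\<close> of
  one outside the other would give the detour a, c, b avoiding the edges of the other block.\<close>

lemma block_unique:
  assumes "i \<in> {1..k}" "j \<in> {1..k}" "a \<in> X i" "a \<in> X j" "b \<in> X i" "b \<in> X j" "a \<noteq> b"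
  shows "i = j"
proof (rule ccontr)
  assume "i \<noteq> j"
  then obtain c where c: "c \<in> X j" "c \<notin> X i"
    using block_not_subset assms by blast
  let ?R = "\<lambda>u v. {u, v} \<in> edges G - edges (B i)"
  have "{a, c} \<in> edges (B j)" "{c, b} \<in> edges (B j)"
    using c assms block_edge_iff by auto
  then have "?R a c" "?R c b"
    using c assms block_edge_iff block_edges_subset by blast+
  then have "?R\<^sup>*\<^sup>* a b"
    by (meson converse_rtranclp_into_rtranclp r_into_rtranclp)
  then show False
    using block_not_linked_outside assms by blast
qed

text \<open>Take a neighbour \<open>c\<close> of \<open>v\<close> in the first block and
  \<open>d\<close> in the second. A walk from \<open>d\<close> to \<open>c\<close> avoiding
  \<open>v\<close> would enter the first block at some \<open>z\<close> other than \<open>v\<close>;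
  preceded by the edge from \<open>v\<close> to \<open>d\<close>, it would link two vertices of that
  block outside it.\<close>

lemma vertex_in_two_blocks_cut:
  assumes i: "i \<in> {1..k}" and j: "j \<in> {1..k}" and "i \<noteq> j" and v: "v \<in> X i" "v \<in> X j"
  shows "cut_vertex G v"
proof -
  obtain c d where c: "c \<in> X i" "c \<notin> X j" and d: "d \<in> X j" "d \<notin> X i"
    using block_not_subset assms by metis
  let ?R = "\<lambda>u v. {u, v} \<in> edges G - edges (B i)"
  have edges: "{v, c} \<in> edges (B i)" "{v, d} \<in> edges (B j)"
    using c d v block_edge_iff i j by auto
  have vd: "?R v d"
    using edges d block_edge_iff[OF i] block_edges_subset[OF j] by blast
  have "\<not> linked (delete_vertex G v) d c"
  proof
    \<comment> \<open>Invariant along the walk: either it is still outside block \<open>i\<close>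
      and has used none of its edges, or block \<open>i\<close> has already been reached at a vertex
      other than \<open>v\<close>.\<close>
    have esc: "(y \<notin> X i \<and> ?R\<^sup>*\<^sup>* d y) \<or> (\<exists>z \<in> X i - {v}. ?R\<^sup>*\<^sup>* d z)"
      if "linked (delete_vertex G v) d y" for y
      using that unfolding linked_def
    proof (induction rule: rtranclp_induct)
      case base
      then show ?case using d by simp
    next
      case (step y z)
      then have yz: "{y, z} \<in> edges G" "z \<noteq> v"
        by (auto simp: delete_vertex_def)
      show ?case
      proof (cases "y \<notin> X i \<and> ?R\<^sup>*\<^sup>* d y")
        case True
        then have "?R y z"
          using yz block_edge_iff[OF i] by blast
        with True have "?R\<^sup>*\<^sup>* d z"
          by (meson rtranclp.rtrancl_into_rtrancl)
        then show ?thesis using yz by blast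
      next
        case False
        then show ?thesis using step by blast
      qed
    qed
    assume "linked (delete_vertex G v) d c"
    then obtain z where "z \<in> X i - {v}" "?R\<^sup>*\<^sup>* d z"
      using esc[of c] c by blast
    then have "?R\<^sup>*\<^sup>* v z"
      using vd by (meson converse_rtranclp_into_rtranclp)
    then show False
      using block_not_linked_outside[OF i, of v z] v \<open>z \<in> X i - {v}\<close> by blast
  qed
  then have "\<not> linked (delete_vertex G v) c d"
    using linked_sym by metis
  then show ?thesis
    using edges block_edges_subset[OF i] block_edges_subset[OF j]
    by (intro cut_vertexI[OF simple, of v c d]) auto
qed

text \<open>Consider the first time \<open>t\<close> after the start at which a step is again taken
  in block \<open>b v\<close>. The steps from \<open>f v\<close> until then avoid the edges of that
  block, and both ends lie in it, so they coincide. General \<open>D\<close> and \<open>b\<close>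
  serve two uses: the cycles of a permutation and the comparison of two assignments.\<close>

lemma closed_walk_stays_in_block:
  assumes closed: "f ` D \<subseteq> D" and "v \<in> D"
    and blk: "\<And>u. u \<in> D \<Longrightarrow> b u \<in> {1..k} \<and> u \<in> X (b u) \<and> f u \<in> X (b u) \<and> u \<noteq> f u"
    and periodic: "(f ^^ p) v = v" "p > 0"
  shows "b (f v) = b v"
proof -
  define Q where "Q t \<longleftrightarrow> t \<ge> 1 \<and> b ((f ^^ t) v) = b v" for t
  define t where "t = (LEAST t. Q t)"
  have "Q p"
    using periodic by (simp add: Q_def)
  then have t: "Q t" and least: "\<And>s. s < t \<Longrightarrow> \<not> Q s"
    unfolding t_def by (auto intro: LeastI dest: not_less_Least)
  have D: "(f ^^ s) v \<in> D" for s
    using closed \<open>v \<in> D\<close> by (induction s) auto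
  let ?R = "\<lambda>x y. {x, y} \<in> edges G - edges (B (b v))"
  have "?R\<^sup>*\<^sup>* (f v) ((f ^^ s) v)" if "1 \<le> s" "s \<le> t" for s
    using that
  proof (induction s rule: dec_induct)
    case base
    then show ?case by simp
  next
    case (step s)
    let ?x = "(f ^^ s) v"
    have "b ?x \<noteq> b v"
      using step least[of s] by (auto simp: Q_def)
    moreover have x: "?x \<in> X (b ?x)" "f ?x \<in> X (b ?x)" "?x \<noteq> f ?x" "b ?x \<in> {1..k}"
      and v: "b v \<in> {1..k}"
      using blk[OF D[of s]] blk[OF \<open>v \<in> D\<close>] by simp_all
    \<comment> \<open>Distinct blocks share at most one vertex, so an edge of another block is not
      an edge of block \<open>b v\<close>.\<close>
    ultimately have "{?x, f ?x} \<notin> edges (B (b v))"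
      using block_unique[OF x(4) v x(1) _ x(2) _ x(3)] by (auto simp: block_edge_iff[OF v])
    moreover have "{?x, f ?x} \<in> edges G"
      using x block_edge_iff[OF x(4)] block_edges_subset[OF x(4)] by blast
    ultimately have "?R ?x (f ?x)"
      by simp
    moreover have "?R\<^sup>*\<^sup>* (f v) ?x"
      using step by simp
    ultimately show ?case
      by (simp add: rtranclp.rtrancl_into_rtrancl)
  qed
  then have "?R\<^sup>*\<^sup>* (f v) ((f ^^ t) v)"
    using t by (auto simp: Q_def)
  moreover have "(f ^^ t) v \<in> X (b v)"
    using t blk[OF D[of t]] by (auto simp: Q_def)
  ultimately have "(f ^^ t) v = f v"
    using block_not_linked_outside[of "b v" "f v" "(f ^^ t) v"] blk[OF \<open>v \<in> D\<close>] by metis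
  then show ?thesis
    using t by (simp add: Q_def)
qed

end

section \<open>Assignments of vertices to blocks\<close>

context block_graph
begin

definition assignments :: "('v \<Rightarrow> nat) set" where
  "assignments = {\<phi>. \<forall>v. \<phi> v \<in> {1..k} \<and> v \<in> X (\<phi> v)}"

lemma finite_assignments: "finite assignments"
proof (rule finite_subset)
  show "assignments \<subseteq> UNIV \<rightarrow>\<^sub>E {1..k}"
    by (auto simp: assignments_def)
qed (auto intro: finite_PiE)

text \<open>Every cycle of a permutation moving all vertices along edges stays inside one block, so the
  Leibniz expansion splits according to the block containing the edge \<open>{v, p v}\<close>.\<close>

lemma det_eq_sum_assignments:
  fixes M :: "'a::field^'v^'v"
  assumes M: "\<And>u v. {u, v} \<notin> edges G \<Longrightarrow> M $ u $ v = 0"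
  shows "det M = (\<Sum>\<phi>\<in>assignments. det (\<chi> u v. if \<phi> v = \<phi> u then M $ u $ v else 0))"
proof -
  have perm: "(\<Prod>v\<in>UNIV. M $ v $ p v) = (\<Sum>\<phi>\<in>assignments. \<Prod>v\<in>UNIV. if \<phi> (p v) = \<phi> v then M $ v $ p v else 0)"
    if p: "p permutes UNIV" for p
  proof (cases "\<exists>v. M $ v $ p v = 0")
    case True
    then obtain v where v: "M $ v $ p v = 0" by blast
    then have "(\<Prod>v\<in>UNIV. M $ v $ p v) = 0"
      by (intro prod_zero) auto
    moreover have "(\<Prod>v\<in>UNIV. if \<phi> (p v) = \<phi> v then M $ v $ p v else 0) = 0" for \<phi> :: "'v \<Rightarrow> nat"
      using v by (intro prod_zero) auto
    ultimately show ?thesis by (simp only: sum.neutral_const)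
  next
    case False
    then have edge: "{v, p v} \<in> edges G" for v
      using M by blast
    then have "\<exists>i. i \<in> {1..k} \<and> v \<in> X i \<and> p v \<in> X i" for v
      using edge_in_some_block by blast
    then obtain b where b: "\<And>v. b v \<in> {1..k} \<and> v \<in> X (b v) \<and> p v \<in> X (b v)"
      by metis
    \<comment> \<open>Each orbit of \<open>p\<close> is a closed walk along edges, hence stays in
      one block.\<close>
    have b_inv: "b (p v) = b v" for v
    proof -
      obtain n where "n > 0" "(p ^^ n) v = v"
        using funpow_inj_finite[OF permutes_inj[OF p], of v] by auto
      then show ?thesis
        using b edge_ne[OF edge] by (intro closed_walk_stays_in_block[of p UNIV v b n]) auto
    qed
    \<comment> \<open>Only \<open>\<phi> = b\<close> survives: if \<open>\<phi>\<close> is constant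
      along \<open>p\<close>, then block \<open>\<phi> v\<close> contains both \<open>v\<close> and
      \<open>p v\<close>, and these two distinct vertices determine the block.\<close>
    have "(\<Prod>v\<in>UNIV. if \<phi> (p v) = \<phi> v then M $ v $ p v else 0)
        = (if \<phi> = b then \<Prod>v\<in>UNIV. M $ v $ p v else 0)" if \<phi>: "\<phi> \<in> assignments" for \<phi>
    proof (cases "\<forall>v. \<phi> (p v) = \<phi> v")
      case True
      have "\<phi> v = b v" for v
      proof -
        have "\<phi> v \<in> {1..k}" "v \<in> X (\<phi> v)" "p v \<in> X (\<phi> v)"
          using \<phi> True[rule_format, of v] unfolding assignments_def by (blast, blast, metis (mono_tags) mem_Collect_eq)
        then show ?thesis
          using block_unique[of "\<phi> v" "b v" v "p v"] b[of v] edge_ne[OF edge] by blast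
      qed
      then have "\<phi> = b" by blast
      then show ?thesis using True by simp
    next
      case False
      then have "(\<Prod>v\<in>UNIV. if \<phi> (p v) = \<phi> v then M $ v $ p v else 0) = 0"
        by (intro prod_zero) auto
      moreover have "\<phi> \<noteq> b"
        using False b_inv by auto
      ultimately show ?thesis by simp
    qed
    moreover have "b \<in> assignments"
      using b by (simp add: assignments_def)
    ultimately show ?thesis
      using finite_assignments by simp
  qed
  have "det M = (\<Sum>p | p permutes UNIV. of_int (sign p) *
      (\<Sum>\<phi>\<in>assignments. \<Prod>v\<in>UNIV. if \<phi> (p v) = \<phi> v then M $ v $ p v else 0))"
    unfolding det_def using perm by (intro sum.cong) auto
  also have "\<dots> = (\<Sum>\<phi>\<in>assignments. det (\<chi> u v. if \<phi> v = \<phi> u then M $ u $ v else 0))"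
    unfolding det_def sum_distrib_left by (subst sum.swap) simp
  finally show ?thesis .
qed

text \<open>Where the assignments differ at \<open>v\<close>, the fibre of \<open>\<psi>\<close>
  over \<open>\<psi> v\<close> gains \<open>v\<close>, so by equal sizes it loses some
  \<open>f v\<close> that \<open>\<phi>\<close> sends there. Iterating \<open>f\<close> gives a walk
  whose consecutive vertices share a block, and on a finite set it closes up. It must then stay in
  one block, against the choice of \<open>f\<close>.\<close>

lemma assignment_determined_by_fibre_cards:
  assumes \<phi>: "\<phi> \<in> assignments" and \<psi>: "\<psi> \<in> assignments"
    and card_eq: "\<And>i. i \<in> {1..k} \<Longrightarrow> card {v. \<phi> v = i} = card {v. \<psi> v = i}"
  shows "\<phi> = \<psi>"
proof (rule ccontr)
  assume "\<phi> \<noteq> \<psi>"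
  then obtain v0 where v0: "\<phi> v0 \<noteq> \<psi> v0" by blast
  define D where "D = {v. \<phi> v \<noteq> \<psi> v}"
  have in_X: "\<phi> v \<in> {1..k}" "v \<in> X (\<phi> v)" "\<psi> v \<in> {1..k}" "v \<in> X (\<psi> v)" for v
    using \<phi> \<psi> unfolding assignments_def by blast+
  have "\<exists>u. \<phi> u = \<psi> v \<and> \<psi> u \<noteq> \<psi> v" if "v \<in> D" for v
  proof (rule ccontr)
    assume "\<not> ?thesis"
    then have "{u. \<phi> u = \<psi> v} \<subseteq> {u. \<psi> u = \<psi> v}" by blast
    then have "{u. \<phi> u = \<psi> v} = {u. \<psi> u = \<psi> v}"
      using card_eq[OF in_X(3)] by (intro card_subset_eq) auto
    then have "\<phi> v = \<psi> v" by blast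
    then show False using that by (simp add: D_def)
  qed
  then obtain f where f: "\<And>v. v \<in> D \<Longrightarrow> \<phi> (f v) = \<psi> v \<and> \<psi> (f v) \<noteq> \<psi> v"
    by metis
  have D: "f ` D \<subseteq> D"
    using f by (force simp: D_def)
  have orbit: "(f ^^ s) v0 \<in> D" for s
    using v0 D by (induction s) (auto simp: D_def)
  have "\<not> inj (\<lambda>s. (f ^^ s) v0)"
    using finite_imageD[of "\<lambda>s. (f ^^ s) v0" UNIV] infinite_UNIV_nat by (meson finite)
  then obtain s t where "s < t" and st: "(f ^^ s) v0 = (f ^^ t) v0"
    unfolding inj_on_def by (metis nat_neq_iff)
  \<comment> \<open>The orbit of \<open>v0\<close> may have a tail before it repeats;
    \<open>u\<close> lies on the periodic part, with period \<open>t - s\<close>.\<close>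
  define u where "u = (f ^^ s) v0"
  have "t = (t - s) + s"
    using \<open>s < t\<close> by simp
  then have "(f ^^ (t - s)) u = u"
    unfolding u_def using st by (metis comp_apply funpow_add)
  moreover have u: "u \<in> D"
    unfolding u_def by (rule orbit)
  moreover have "\<psi> x \<in> {1..k} \<and> x \<in> X (\<psi> x) \<and> f x \<in> X (\<psi> x) \<and> x \<noteq> f x" if "x \<in> D" for x
    using f[OF that] in_X(3,4)[of x] in_X(2)[of "f x"] by auto
  ultimately have "\<psi> (f u) = \<psi> u"
    using D \<open>s < t\<close> by (intro closed_walk_stays_in_block[of f D u \<psi> "t - s"]) auto
  then show False
    using f[OF u] by simp
qed

text \<open>Injectivity is the absence of cycles of blocks. Fibre sizes are admissible because the
  vertices assigned to \<open>S\<close> lie in the blocks of \<open>S\<close>; conversely Hall's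
  theorem realises every admissible tuple. Restriction to \<open>{1..k}\<close> matches the
  extensional encoding of tuples.\<close>

lemma bij_assignments_admissible_tuples:
  assumes G: "verts G = UNIV"
  shows "bij_betw (\<lambda>\<phi>. \<lambda>i\<in>{1..k}. card {v. \<phi> v = i}) assignments (admissible_tuples G k B)"
proof (rule bij_betw_imageI)
  let ?c = "\<lambda>\<phi>. \<lambda>i\<in>{1..k}. card {v :: 'v. \<phi> v = i}"
  show "inj_on ?c assignments"
  proof (rule inj_onI)
    fix \<phi> \<psi> assume "\<phi> \<in> assignments" "\<psi> \<in> assignments" and eq: "?c \<phi> = ?c \<psi>"
    moreover have "card {v. \<phi> v = i} = card {v. \<psi> v = i}" if "i \<in> {1..k}" for i
      using fun_cong[OF eq, of i] that by simp
    ultimately show "\<phi> = \<psi>"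
      by (intro assignment_determined_by_fibre_cards)
  qed
  have fibres: "(\<Sum>i\<in>S. ?c \<phi> i) = card {v. \<phi> v \<in> S}" if "S \<subseteq> {1..k}" for S and \<phi> :: "'v \<Rightarrow> nat"
  proof -
    have "(\<Sum>i\<in>S. ?c \<phi> i) = (\<Sum>i\<in>S. card {v. \<phi> v = i})"
      using that by (intro sum.cong) auto
    also have "\<dots> = card (\<Union>i\<in>S. {v. \<phi> v = i})"
      using finite_subset[OF that] by (intro card_UN_disjoint[symmetric]) auto
    also have "(\<Union>i\<in>S. {v. \<phi> v = i}) = {v. \<phi> v \<in> S}" by auto
    finally show ?thesis .
  qed
  show "?c ` assignments = admissible_tuples G k B"
  proof (intro equalityI subsetI)
    fix \<alpha> assume "\<alpha> \<in> ?c ` assignments"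
    then obtain \<phi> where \<phi>: "\<phi> \<in> assignments" and \<alpha>: "\<alpha> = ?c \<phi>" by blast
    have "(\<Sum>i=1..k. \<alpha> i) = card (verts G)"
    proof -
      have "{v. \<phi> v \<in> {1..k}} = UNIV"
        using \<phi> by (auto simp: assignments_def)
      then show ?thesis
        using fibres[of "{1..k}" \<phi>] by (simp add: \<alpha> G)
    qed
    moreover have "(\<Sum>i\<in>S. \<alpha> i) \<le> card (\<Union>i\<in>S. X i)" if "S \<subseteq> {1..k}" for S
    proof -
      have "{v. \<phi> v \<in> S} \<subseteq> (\<Union>i\<in>S. X i)"
        using \<phi> by (auto simp: assignments_def)
      then show ?thesis
        unfolding \<alpha> fibres[OF that] by (intro card_mono) auto
    qed
    ultimately show "\<alpha> \<in> admissible_tuples G k B"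
      by (auto simp: admissible_tuples_def \<alpha>)
  next
    fix \<alpha> assume \<alpha>: "\<alpha> \<in> admissible_tuples G k B"
    have "\<exists>\<phi>. (\<forall>v. \<phi> v \<in> {1..k} \<and> v \<in> X (\<phi> v)) \<and> (\<forall>i\<in>{1..k}. card {v. \<phi> v = i} = \<alpha> i)"
      using \<alpha> G by (intro assignment_with_prescribed_fibres) (auto simp: admissible_tuples_def)
    then obtain \<phi> where "\<phi> \<in> assignments" "\<forall>i\<in>{1..k}. card {v. \<phi> v = i} = \<alpha> i"
      by (auto simp: assignments_def)
    moreover from this have "\<alpha> = ?c \<phi>"
      using \<alpha> by (auto simp: admissible_tuples_def fun_eq_iff PiE_def extensional_def)
    ultimately show "\<alpha> \<in> ?c ` assignments" by blast
  qed
qed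

end

section \<open>The determinant of a signed block graph\<close>

text \<open>Translates the block factor of the final formula into the fibre factor of the
  determinant computation; with q = 1 - 2r both sides become rational expressions in q. The minus
  sign, taken once for each of the \<open>k\<close> blocks, turns (-1)^n into (-1)^(n-k).\<close>

lemma clique_factor_eq:
  fixes a :: real
  shows "(1 - 2 * real r) powi (int m - 1) * (-1) powi (- int (m * r)) *
      (a * (1 - 2 * real r) + 2 * real r * (1 + real m * (real r - 1)) - 1)
    = - ((-1) ^ (m * r) * (1 - 2 * real r) ^ m *
        (1 - (a - real (m * r)) + real (m * r) / (1 - 2 * real r)))"
proof -
  define q where "q = 1 - 2 * real r"
  have q: "q \<noteq> 0"
    unfolding q_def by (rule one_minus_double_neq_0)
  have r: "real r = (1 - q) / 2"
    by (simp add: q_def)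
  have "q powi (int m - 1) = q ^ m / q"
    using q by (simp add: power_int_diff)
  moreover have "(-1 :: real) powi (- int (m * r)) = (-1) ^ (m * r)"
    by (simp only: power_int_minus power_int_of_nat flip: power_inverse) simp
  moreover have "a * q + 2 * real r * (1 + real m * (real r - 1)) - 1
      = - (q * (1 - (a - real (m * r)) + real (m * r) / q))"
    using q by (simp add: r field_simps)
  ultimately show ?thesis
    using q by (simp flip: q_def)
qed

text \<open>Cliques on at most one vertex contain no edge, and the factor of a block does not depend on
  their number.\<close>

lemma clique_factor_trivial:
  fixes a :: real
  assumes "r \<le> 1"
  shows "(-1) ^ (m * r) * (1 - 2 * real r) ^ m *
        (1 - (a - real (m * r)) + real (m * r) / (1 - 2 * real r)) = 1 - a"
proof -
  from assms consider "r = 0" | "r = 1" by linarith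
  then show ?thesis
    by cases (simp_all flip: power_mult_distrib)
qed

theorem theorem7:
  fixes G :: "('v::finite) graph" and w :: "'v set \<Rightarrow> real"
    and n k :: nat and B :: "nat \<Rightarrow> 'v graph"
    and m r :: "nat \<Rightarrow> nat" and C :: "nat \<Rightarrow> nat \<Rightarrow> 'v set"
  assumes "signed_block_graph G w"
    and "verts G = UNIV" and "n = card (verts G)"
    and "bij_betw B {1..k} {H. is_block G H}"
    and "\<And>x e. cut_vertex G x \<Longrightarrow> e \<in> edges G \<Longrightarrow> x \<in> e \<Longrightarrow> w e = 1"
    and "\<And>i j. i \<in> {1..k} \<Longrightarrow> j \<in> {1..m i} \<Longrightarrow>
           negative_clique (B i) w (C i j) \<and> card (C i j) = r i"
    and "\<And>i. i \<in> {1..k} \<Longrightarrow> disjoint_family_on (C i) {1..m i}"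
    and "\<And>i. i \<in> {1..k} \<Longrightarrow> int (m i * r i) \<le> int (card (verts (B i))) - 1"
    and "\<And>i e. i \<in> {1..k} \<Longrightarrow> e \<in> edges (B i) \<Longrightarrow>
           \<not> (\<exists>j\<in>{1..m i}. e \<subseteq> C i j) \<Longrightarrow> w e = 1"
  shows "det (adjacency_matrix G w) =
    (-1) powi (int n - int k) *
    (\<Sum>\<alpha>\<in>admissible_tuples G k B.
      \<Prod>i=1..k. (1 - 2 * real (r i)) powi (int (m i) - 1) * (-1) powi (- int (m i * r i)) *
        (real (\<alpha> i) * (1 - 2 * real (r i))
          + 2 * real (r i) * (1 + real (m i) * (real (r i) - 1)) - 1))"
proof -
  have sbg: "signed_graph G w" "\<And>H. is_block G H \<Longrightarrow> complete_graph H"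
    using assms(1) by (auto simp: signed_block_graph_def)
  then interpret block_graph G k B
    using assms(4) by unfold_locales (auto simp: signed_graph_def)
  \<comment> \<open>Cliques on at most one vertex are discarded: such a vertex may be a cut-vertex
    assigned to another block, so the clique need not lie in the fibre of its own block.\<close>
  define m' where "m' i = (if r i \<le> 1 then 0 else m i)" for i
  define F where "F i a = (-1) ^ (m' i * r i) * (1 - 2 * real (r i)) ^ m' i *
      (1 - (a - real (m' i * r i)) + real (m' i * r i) / (1 - 2 * real (r i)))" for i a
  have clique: "negative_clique (B i) w (C i j)" "card (C i j) = r i" "2 \<le> r i" "j \<in> {1..m i}"
    if "i \<in> {1..k}" "j \<in> {1..m' i}" for i j
    using that assms(6)[of i j] by (auto simp: m'_def split: if_splits)
  have clique_edge: "{u, v} \<in> edges G \<and> w {u, v} = -1"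
    if i: "i \<in> {1..k}" and j: "j \<in> {1..m' i}" and "u \<in> C i j" "v \<in> C i j" "u \<noteq> v" for i j u v
    using clique(1)[OF i j] that block_edges_subset[OF i] by (auto simp: negative_clique_def)

  have det_\<phi>: "det (\<chi> u v. if \<phi> v = \<phi> u then adjacency_matrix G w $ u $ v else 0)
      = (-1) ^ n * (\<Prod>i=1..k. F i (real (card {v. \<phi> v = i})))" if \<phi>: "\<phi> \<in> assignments" for \<phi>
  proof -
    have in_X: "\<phi> v \<in> {1..k}" "v \<in> X (\<phi> v)" for v
      using \<phi> by (auto simp: assignments_def)
    \<comment> \<open>A remaining clique has a negative edge at each of its vertices, so none of
      them is a cut-vertex; each lies in block \<open>i\<close> only and \<open>\<phi>\<close> has
      no other choice.\<close>
    have fibre: "\<phi> v = i" if i: "i \<in> {1..k}" and j: "j \<in> {1..m' i}" and v: "v \<in> C i j" for i j v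
    proof (rule ccontr)
      assume "\<phi> v \<noteq> i"
      moreover have "v \<in> X i"
        using clique(1)[OF i j] v by (auto simp: negative_clique_def)
      ultimately have cut: "cut_vertex G v"
        using vertex_in_two_blocks_cut[OF in_X(1) i] in_X(2) by blast
      have "\<not> C i j \<subseteq> {v}"
        using clique(2,3)[OF i j] card_mono[of "{v}" "C i j"] by auto
      then obtain u where "u \<in> C i j" "u \<noteq> v" by blast
      then have "{u, v} \<in> edges G" "w {u, v} = -1"
        using clique_edge[OF i j _ v] by auto
      then show False
        using assms(5)[OF cut, of "{u, v}"] by simp
    qed
    have "(\<chi> u v. if \<phi> v = \<phi> u then adjacency_matrix G w $ u $ v else 0)
      = (\<chi> u v. if \<phi> v = \<phi> u \<and> u \<noteq> v
          then if \<exists>j\<in>{1..m' (\<phi> u)}. u \<in> C (\<phi> u) j \<and> v \<in> C (\<phi> u) j then -1 else 1 else 0)"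
    proof -
      have "adjacency_matrix G w $ u $ v
          = (if \<exists>j\<in>{1..m' (\<phi> u)}. u \<in> C (\<phi> u) j \<and> v \<in> C (\<phi> u) j then -1 else 1)"
        if eq: "\<phi> v = \<phi> u" and ne: "u \<noteq> v" for u v
      proof -
        let ?i = "\<phi> u"
        have eB: "{u, v} \<in> edges (B ?i)"
          using in_X[of u] in_X[of v] eq ne by (simp add: block_edge_iff)
        then have eG: "{u, v} \<in> edges G"
          using block_edges_subset[OF in_X(1)] by blast
        show ?thesis
        proof (cases "\<exists>j\<in>{1..m' ?i}. u \<in> C ?i j \<and> v \<in> C ?i j")
          case True
          then show ?thesis
            using clique_edge[OF in_X(1)] ne by (auto simp: adjacency_matrix_def)
        next
          case False
          \<comment> \<open>Two distinct vertices in a clique force \<open>2 \<le> r ?i\<close>, so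
            no clique containing an edge was discarded.\<close>
          have "\<not> {u, v} \<subseteq> C ?i j" if j: "j \<in> {1..m ?i}" for j
          proof
            assume sub: "{u, v} \<subseteq> C ?i j"
            have "2 \<le> r ?i"
              using card_mono[OF finite sub] assms(6)[OF in_X(1) j] ne by simp
            then show False
              using False j sub by (auto simp: m'_def)
          qed
          then have "w {u, v} = 1"
            using assms(9)[OF in_X(1) eB] by blast
          then show ?thesis
            using False eG by (simp add: adjacency_matrix_def)
        qed
      qed
      moreover have "adjacency_matrix G w $ u $ u = 0" for u
        using edge_ne[of u u] by (auto simp: adjacency_matrix_def)
      ultimately show ?thesis
        by (auto simp: vec_eq_iff)
    qed
    also have "det \<dots> = (-1) ^ CARD('v) * (\<Prod>i=1..k. F i (real (card {v. \<phi> v = i})))"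
      unfolding F_def
    proof (rule det_cliquewise_signed)
      show "disjoint_family_on (C i) {1..m' i}" if "i \<in> {1..k}" for i
        using assms(7)[OF that] by (auto simp: m'_def disjoint_family_on_def)
    qed (use in_X fibre clique in auto)
    finally show ?thesis
      using assms(2,3) by simp
  qed

  \<comment> \<open>When the cliques of block \<open>i\<close> were discarded, the factor computed
    with \<open>m' i = 0\<close> still agrees with the one for \<open>m i\<close>.\<close>
  have F: "F i (real a) = - ((1 - 2 * real (r i)) powi (int (m i) - 1) * (-1) powi (- int (m i * r i)) *
        (real a * (1 - 2 * real (r i)) + 2 * real (r i) * (1 + real (m i) * (real (r i) - 1)) - 1))"
    for i a
    unfolding clique_factor_eq F_def m'_def
    using clique_factor_trivial[of "r i" "m i" "real a"] by simp
  let ?s = "\<lambda>\<alpha> i. (1 - 2 * real (r i)) powi (int (m i) - 1) * (-1) powi (- int (m i * r i)) *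
        (real (\<alpha> i) * (1 - 2 * real (r i)) + 2 * real (r i) * (1 + real (m i) * (real (r i) - 1)) - 1)"
  have sign: "(-1 :: real) powi (int n - int k) = (-1) ^ n * (-1) ^ k"
    by (simp add: power_int_diff divide_inverse flip: power_inverse)
  have "det (adjacency_matrix G w)
      = (\<Sum>\<phi>\<in>assignments. (-1) ^ n * (\<Prod>i=1..k. F i (real (card {v. \<phi> v = i}))))"
  proof -
    have "det (adjacency_matrix G w)
        = (\<Sum>\<phi>\<in>assignments. det (\<chi> u v. if \<phi> v = \<phi> u then adjacency_matrix G w $ u $ v else 0))"
      by (rule det_eq_sum_assignments) (simp add: adjacency_matrix_def)
    also have "\<dots> = (\<Sum>\<phi>\<in>assignments. (-1) ^ n * (\<Prod>i=1..k. F i (real (card {v. \<phi> v = i}))))"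
      by (intro sum.cong refl det_\<phi>)
    finally show ?thesis .
  qed
  also have "\<dots> = (\<Sum>\<phi>\<in>assignments. (-1) powi (int n - int k) *
      prod (?s (\<lambda>i\<in>{1..k}. card {v. \<phi> v = i})) {1..k})"
    unfolding F prod_uminus sign by (intro sum.cong refl) (simp add: mult.assoc)
  \<comment> \<open>The summand depends on \<open>\<phi>\<close> only through its fibre sizes, so
    the sum can be reindexed by admissible tuples.\<close>
  also have "\<dots> = (\<Sum>\<alpha>\<in>admissible_tuples G k B. (-1) powi (int n - int k) * prod (?s \<alpha>) {1..k})"
    by (rule sum.reindex_bij_betw[OF bij_assignments_admissible_tuples[OF assms(2)]])
  finally show ?thesis
    by (simp only: sum_distrib_left)
qed

end
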